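(* Every state on an effect algebra $E$ induces a state operator on the tensor product $[0,1]\otimes E$.
   Context: An effect algebra is $(E;0,1,\oplus)$ with a partial binary operation $\oplus$ that is commutative and associative (in the partial sense), such that for each $e$ there is a unique $e^\perp$ with $e\oplus e^\perp=1$, and $e\oplus 1$ is defined only if $e=0$. Write $a\perp b$ if $a\oplus b$ is defined. The real interval $[0,1]$ is an effect algebra with $a\oplus b=a+b$ defined iff $a+b\le 1$. A morphism $\phi:E\to F$ satisfies $\phi(1)=1$ and: $a\perp b$ implies $\phi(a)\perp\phi(b)$ and $\phi(a\oplus b)=\phi(a)\oplus\phi(b)$. A state on $E$ is a morphism $E\to[0,1]$. A bimorphism $\beta:E\times F\to L$ preserves existing orthosums in each variable separately and satisfies $\beta(1,1)=1$. A tensor product of $E$ and $F$ in the category of effect algebras is a pair $(T,\rho)$ with $T$ an effect algebra and $\rho:E\times F\to T$ a bimorphism such that for every effect algebra $L$ and bimorphism $\beta:E\times F\to L$ there is a unique morphism $\phi:T\to L$ with $\beta=\phi\circ\rho$; write $T=E\otimes F$. It is known that the tensor product of two effect algebras exists if each of them has at least one state. A state operator on an effect algebra $E$ is a map $\tau:E\to E$ with $\tau(1)=1$; $\tau(e\oplus f)=\tau(e)\oplus\tau(f)$ whenever $e\oplus f$ is defined; and $\tau(\tau(a))=\tau(a)$ for all $a$. *)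

theory Defs
  imports Complex_Main
begin

text \<open>
  The partial operation is option-valued: \<open>osum E a b = Some c\<close> says that \<open>a \<oplus> b\<close> is defined and
  equals \<open>c\<close>, and \<open>osum E a b = None\<close> that it is undefined.  Values of \<open>osum E\<close> outside the
  carrier are irrelevant.
\<close>

record 'a effect_struct =
  carrier :: "'a set"
  ezero :: 'a
  eone :: 'a
  osum :: "'a \<Rightarrow> 'a \<Rightarrow> 'a option"

locale effect_algebra =
  fixes E :: "'a effect_struct"
  assumes zero_closed: "ezero E \<in> carrier E"
    and one_closed: "eone E \<in> carrier E"
    and osum_closed:
      "\<lbrakk>a \<in> carrier E; b \<in> carrier E; osum E a b = Some c\<rbrakk> \<Longrightarrow> c \<in> carrier E"
    and osum_commute:
      "\<lbrakk>a \<in> carrier E; b \<in> carrier E\<rbrakk> \<Longrightarrow> osum E a b = osum E b a"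
    and osum_assoc:
      "\<lbrakk>a \<in> carrier E; b \<in> carrier E; c \<in> carrier E;
        osum E a b = Some d; osum E d c = Some e\<rbrakk>
       \<Longrightarrow> \<exists>f. osum E b c = Some f \<and> osum E a f = Some e"
    and orthosupplement:
      "a \<in> carrier E \<Longrightarrow> \<exists>!b. b \<in> carrier E \<and> osum E a b = Some (eone E)"
    and osum_one:
      "\<lbrakk>a \<in> carrier E; osum E a (eone E) \<noteq> None\<rbrakk> \<Longrightarrow> a = ezero E"

definition unit_interval :: "real effect_struct" where
  "unit_interval = \<lparr>carrier = {0..1}, ezero = 0, eone = 1,
     osum = (\<lambda>a b. if a + b \<le> 1 then Some (a + b) else None)\<rparr>"

definition morphism :: "'a effect_struct \<Rightarrow> 'b effect_struct \<Rightarrow> ('a \<Rightarrow> 'b) \<Rightarrow> bool" where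
  "morphism E F \<phi> \<longleftrightarrow>
     (\<forall>a \<in> carrier E. \<phi> a \<in> carrier F) \<and>
     \<phi> (eone E) = eone F \<and>
     (\<forall>a \<in> carrier E. \<forall>b \<in> carrier E. \<forall>c.
        osum E a b = Some c \<longrightarrow> osum F (\<phi> a) (\<phi> b) = Some (\<phi> c))"

definition state :: "'a effect_struct \<Rightarrow> ('a \<Rightarrow> real) \<Rightarrow> bool" where
  "state E s \<longleftrightarrow> morphism E unit_interval s"

definition bimorphism ::
    "'a effect_struct \<Rightarrow> 'b effect_struct \<Rightarrow> 'c effect_struct \<Rightarrow> ('a \<times> 'b \<Rightarrow> 'c) \<Rightarrow> bool" where
  "bimorphism E F L \<beta> \<longleftrightarrow>
     (\<forall>a \<in> carrier E. \<forall>b \<in> carrier F. \<beta> (a, b) \<in> carrier L) \<and>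
     \<beta> (eone E, eone F) = eone L \<and>
     (\<forall>a \<in> carrier E. \<forall>a' \<in> carrier E. \<forall>c. \<forall>b \<in> carrier F.
        osum E a a' = Some c \<longrightarrow> osum L (\<beta> (a, b)) (\<beta> (a', b)) = Some (\<beta> (c, b))) \<and>
     (\<forall>a \<in> carrier E. \<forall>b \<in> carrier F. \<forall>b' \<in> carrier F. \<forall>c.
        osum F b b' = Some c \<longrightarrow> osum L (\<beta> (a, b)) (\<beta> (a, b')) = Some (\<beta> (a, c)))"

text \<open>
  \<open>\<phi>\<close> is the morphism from \<open>T\<close> to \<open>L\<close> with \<open>\<beta> = \<phi> \<circ> \<rho>\<close>; extensionality makes equality of such
  functions the same as equality on the carrier of \<open>T\<close>.
\<close>

definition factors_through ::
    "'a effect_struct \<Rightarrow> 'b effect_struct \<Rightarrow> 't effect_struct \<Rightarrow> ('a \<times> 'b \<Rightarrow> 't) \<Rightarrow>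
     'l effect_struct \<Rightarrow> ('a \<times> 'b \<Rightarrow> 'l) \<Rightarrow> ('t \<Rightarrow> 'l) \<Rightarrow> bool" where
  "factors_through E F T \<rho> L \<beta> \<phi> \<longleftrightarrow>
     (\<forall>t. t \<notin> carrier T \<longrightarrow> \<phi> t = undefined) \<and>
     morphism T L \<phi> \<and>
     (\<forall>a \<in> carrier E. \<forall>b \<in> carrier F. \<phi> (\<rho> (a, b)) = \<beta> (a, b))"

text \<open>
  A definition cannot quantify over all types, so the codomains \<open>L\<close> range over the effect algebras
  on the type \<open>'t + 'a \<times> 'b \<times> nat\<close>.  This type is large enough to yield the universal property
  against effect algebras on every type, which is the lemma \<open>tensor_product_universal\<close> below.
\<close>

definition tensor_product ::
    "'a effect_struct \<Rightarrow> 'b effect_struct \<Rightarrow> 't effect_struct \<Rightarrow> ('a \<times> 'b \<Rightarrow> 't) \<Rightarrow> bool" where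
  "tensor_product E F T \<rho> \<longleftrightarrow>
     effect_algebra T \<and> bimorphism E F T \<rho> \<and>
     (\<forall>(L :: ('t + 'a \<times> 'b \<times> nat) effect_struct) \<beta>.
        effect_algebra L \<longrightarrow> bimorphism E F L \<beta> \<longrightarrow> (\<exists>!\<phi>. factors_through E F T \<rho> L \<beta> \<phi>))"

definition state_operator :: "'a effect_struct \<Rightarrow> ('a \<Rightarrow> 'a) \<Rightarrow> bool" where
  "state_operator E \<tau> \<longleftrightarrow>
     (\<forall>a \<in> carrier E. \<tau> a \<in> carrier E) \<and>
     \<tau> (eone E) = eone E \<and>
     (\<forall>a \<in> carrier E. \<forall>b \<in> carrier E. \<forall>c.
        osum E a b = Some c \<longrightarrow> osum E (\<tau> a) (\<tau> b) = Some (\<tau> c)) \<and>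
     (\<forall>a \<in> carrier E. \<tau> (\<tau> a) = \<tau> a)"


subsection \<open>The universal property against effect algebras on an arbitrary type\<close>

definition subalgebra :: "'a effect_struct \<Rightarrow> 'a set \<Rightarrow> bool" where
  "subalgebra L S \<longleftrightarrow> S \<subseteq> carrier L \<and> ezero L \<in> S \<and> eone L \<in> S \<and>
     (\<forall>a\<in>S. \<forall>b\<in>S. \<forall>c. osum L a b = Some c \<longrightarrow> c \<in> S) \<and>
     (\<forall>a\<in>S. \<forall>b\<in>carrier L. osum L a b = Some (eone L) \<longrightarrow> b \<in> S)"

definition copy :: "('a \<Rightarrow> 'b) \<Rightarrow> 'a set \<Rightarrow> 'a effect_struct \<Rightarrow> 'b effect_struct" where
  "copy g S L = \<lparr>carrier = g ` S, ezero = g (ezero L), eone = g (eone L),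
     osum = (\<lambda>x y. map_option g (osum L (inv_into S g x) (inv_into S g y)))\<rparr>"

lemma osum_copy:
  assumes "inj_on g S" and "a \<in> S" and "b \<in> S"
  shows "osum (copy g S L) (g a) (g b) = map_option g (osum L a b)"
  using assms by (simp add: copy_def)

lemma effect_algebra_copy:
  assumes L: "effect_algebra L" and S: "subalgebra L S" and g: "inj_on g S"
  shows "effect_algebra (copy g S L)"
proof -
  interpret effect_algebra L by fact
  have sub: "\<And>a. a \<in> S \<Longrightarrow> a \<in> carrier L" using S unfolding subalgebra_def by blast
  have cl: "\<And>a b c. \<lbrakk>a \<in> S; b \<in> S; osum L a b = Some c\<rbrakk> \<Longrightarrow> c \<in> S"
    and one: "eone L \<in> S" and zero: "ezero L \<in> S"
    and comp: "\<And>a b. \<lbrakk>a \<in> S; b \<in> carrier L; osum L a b = Some (eone L)\<rbrakk> \<Longrightarrow> b \<in> S"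
    using S unfolding subalgebra_def by blast+
  note gi = inv_into_f_f[OF g]
  have os: "\<And>a b. \<lbrakk>a \<in> S; b \<in> S\<rbrakk> \<Longrightarrow> osum (copy g S L) (g a) (g b) = map_option g (osum L a b)"
    by (simp add: copy_def gi)
  show ?thesis
  proof
    show "ezero (copy g S L) \<in> carrier (copy g S L)" "eone (copy g S L) \<in> carrier (copy g S L)"
      using one zero by (auto simp: copy_def)
  next
    fix a b c assume ab: "a \<in> carrier (copy g S L)" "b \<in> carrier (copy g S L)"
      and c: "osum (copy g S L) a b = Some c"
    from ab obtain a' b' where a'b': "a' \<in> S" "a = g a'" "b' \<in> S" "b = g b'"
      by (auto simp: copy_def)
    with c obtain c' where "osum L a' b' = Some c'" "c = g c'" by (auto simp: os)
    then show "c \<in> carrier (copy g S L)"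
      using cl[OF a'b'(1,3)] by (simp add: copy_def)
  next
    fix a b assume "a \<in> carrier (copy g S L)" "b \<in> carrier (copy g S L)"
    then obtain a' b' where "a' \<in> S" "a = g a'" "b' \<in> S" "b = g b'"
      by (auto simp: copy_def)
    then show "osum (copy g S L) a b = osum (copy g S L) b a"
      using osum_commute[OF sub sub, of a' b'] by (simp add: os)
  next
    fix a b c d e
    assume *: "a \<in> carrier (copy g S L)" "b \<in> carrier (copy g S L)" "c \<in> carrier (copy g S L)"
      and d: "osum (copy g S L) a b = Some d" and e: "osum (copy g S L) d c = Some e"
    from * obtain a' b' c' where abc: "a' \<in> S" "a = g a'" "b' \<in> S" "b = g b'" "c' \<in> S" "c = g c'"
      by (auto simp: copy_def)
    from d abc obtain d' where d': "osum L a' b' = Some d'" "d = g d'"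
      by (auto simp: os)
    then have "d' \<in> S" using abc cl by blast
    with e abc d' obtain e' where e': "osum L d' c' = Some e'" "e = g e'"
      by (auto simp: os)
    from osum_assoc[OF sub sub sub d'(1) e'(1)] abc obtain f'
      where f': "osum L b' c' = Some f'" "osum L a' f' = Some e'" by blast
    then have "f' \<in> S" using abc cl by blast
    then show "\<exists>f. osum (copy g S L) b c = Some f \<and> osum (copy g S L) a f = Some e"
      using abc f' e' by (auto simp: os)
  next
    fix a assume "a \<in> carrier (copy g S L)"
    then obtain a' where a': "a' \<in> S" "a = g a'" by (auto simp: copy_def)
    from orthosupplement[OF sub[OF a'(1)]] obtain b' where
      b': "b' \<in> carrier L" "osum L a' b' = Some (eone L)"
      and un: "\<And>y. y \<in> carrier L \<Longrightarrow> osum L a' y = Some (eone L) \<Longrightarrow> y = b'" by blast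
    have b'S: "b' \<in> S" using comp a' b' by blast
    show "\<exists>!b. b \<in> carrier (copy g S L) \<and> osum (copy g S L) a b = Some (eone (copy g S L))"
    proof (rule ex1I[of _ "g b'"])
      show "g b' \<in> carrier (copy g S L) \<and> osum (copy g S L) a (g b') = Some (eone (copy g S L))"
        using b'S a' b' by (simp add: os) (simp add: copy_def)
    next
      fix b assume b: "b \<in> carrier (copy g S L) \<and> osum (copy g S L) a b = Some (eone (copy g S L))"
      then obtain y where y: "y \<in> S" "b = g y" by (auto simp: copy_def)
      with b a' obtain o' where o': "osum L a' y = Some o'" "g o' = g (eone L)"
        by (auto simp: os copy_def gi)
      have "o' \<in> S" using cl[OF a'(1) y(1) o'(1)] .
      then have "o' = eone L" using inj_onD[OF g o'(2) _ one] by simp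
      then show "b = g b'" using y o' un sub by blast
    qed
  next
    fix a assume a: "a \<in> carrier (copy g S L)" "osum (copy g S L) a (eone (copy g S L)) \<noteq> None"
    then obtain a' where a': "a' \<in> S" "a = g a'" by (auto simp: copy_def)
    moreover have "eone (copy g S L) = g (eone L)" by (simp add: copy_def)
    ultimately have "osum L a' (eone L) \<noteq> None" using a(2) os one by auto
    then have "a' = ezero L" using osum_one sub a' by blast
    then show "a = ezero (copy g S L)" using a' by (simp add: copy_def)
  qed
qed

lemma morphism_copy:
  assumes "subalgebra L S" and "inj_on g S"
    and "morphism T L \<phi>" and "\<And>t. t \<in> carrier T \<Longrightarrow> \<phi> t \<in> S"
    and "effect_algebra T"
  shows "morphism T (copy g S L) (\<lambda>t. if t \<in> carrier T then g (\<phi> t) else undefined)"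
proof -
  interpret effect_algebra T by fact
  let ?\<psi> = "\<lambda>t. if t \<in> carrier T then g (\<phi> t) else undefined"
  show ?thesis
    unfolding morphism_def
  proof (intro conjI ballI allI impI)
    show "?\<psi> t \<in> carrier (copy g S L)" if "t \<in> carrier T" for t
      using that assms(4) by (simp add: copy_def)
    show "?\<psi> (eone T) = eone (copy g S L)"
      using assms(3) one_closed by (simp add: copy_def morphism_def)
    show "osum (copy g S L) (?\<psi> a) (?\<psi> b) = Some (?\<psi> c)"
      if "a \<in> carrier T" "b \<in> carrier T" "osum T a b = Some c" for a b c
    proof -
      have "osum L (\<phi> a) (\<phi> b) = Some (\<phi> c)"
        using assms(3) that unfolding morphism_def by blast
      then show ?thesis
        using that osum_closed[OF that] assms(4) by (simp add: osum_copy[OF assms(2)])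
    qed
  qed
qed

lemma morphism_copy_inv:
  assumes S: "subalgebra L S" and g: "inj_on g S"
    and m: "morphism T (copy g S L) \<phi>" and T: "effect_algebra T"
  shows "morphism T L (\<lambda>t. if t \<in> carrier T then inv_into S g (\<phi> t) else undefined)"
    (is "morphism T L ?\<psi>")
  unfolding morphism_def
proof (intro conjI ballI allI impI)
  interpret effect_algebra T by fact
  have sub: "\<And>a. a \<in> S \<Longrightarrow> a \<in> carrier L"
    and cl: "\<And>a b c. \<lbrakk>a \<in> S; b \<in> S; osum L a b = Some c\<rbrakk> \<Longrightarrow> c \<in> S" and one: "eone L \<in> S"
    using S unfolding subalgebra_def by blast+
  have in_S: "\<And>t. t \<in> carrier T \<Longrightarrow> inv_into S g (\<phi> t) \<in> S"
    using m by (auto simp: morphism_def copy_def inv_into_into)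
  show "?\<psi> t \<in> carrier L" if "t \<in> carrier T" for t
    using that sub in_S by simp
  show "?\<psi> (eone T) = eone L"
    using m one_closed one g by (simp add: morphism_def copy_def inv_into_f_f)
  show "osum L (?\<psi> a) (?\<psi> b) = Some (?\<psi> c)"
    if "a \<in> carrier T" "b \<in> carrier T" "osum T a b = Some c" for a b c
  proof -
    have c: "c \<in> carrier T" using that osum_closed by blast
    from m that have "osum (copy g S L) (\<phi> a) (\<phi> b) = Some (\<phi> c)" by (auto simp: morphism_def)
    then obtain z where z: "osum L (inv_into S g (\<phi> a)) (inv_into S g (\<phi> b)) = Some z" "g z = \<phi> c"
      by (auto simp: copy_def)
    then have "z \<in> S" using cl in_S that by blast
    then have "inv_into S g (\<phi> c) = z" using g z inv_into_f_f by fastforce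
    then show ?thesis using z that c by simp
  qed
qed

unbundle cardinal_syntax

lemma card_of_Un_ordLeq_infinite:
  assumes "infinite C" and "|A| \<le>o |C|" and "|B| \<le>o |C|"
  shows "|A \<union> B| \<le>o |C|"
  using assms by (intro card_of_Un_ordLeq_infinite_Field) (simp_all add: Field_card_of card_of_card_order_on)

lemma small_subalgebra:
  fixes L :: "'l effect_struct"
  assumes L: "effect_algebra L" and X: "X \<subseteq> carrier L"
    and le: "|X| \<le>o |UNIV :: 'u set|" and inf: "infinite (UNIV :: 'u set)"
  obtains S and g :: "'l \<Rightarrow> 'u" where "X \<subseteq> S" "subalgebra L S" "inj_on g S"
proof -
  interpret effect_algebra L by fact
  define sm where "sm a b = (case osum L a b of None \<Rightarrow> ezero L | Some c \<Rightarrow> c)" for a b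
  define cm where "cm a = (THE b. b \<in> carrier L \<and> osum L a b = Some (eone L))" for a
  define G where "G = rec_nat (X \<union> {ezero L, eone L})
     (\<lambda>_ A. A \<union> cm ` A \<union> (\<lambda>(a, b). sm a b) ` (A \<times> A))"
  have G0: "G 0 = X \<union> {ezero L, eone L}"
    and GS: "G (Suc n) = G n \<union> cm ` G n \<union> (\<lambda>(a, b). sm a b) ` (G n \<times> G n)" for n
    by (simp_all add: G_def)
  have smc: "sm a b \<in> carrier L" if "a \<in> carrier L" "b \<in> carrier L" for a b
    using osum_closed[OF that] zero_closed by (simp add: sm_def split: option.split)
  have cmu: "cm a = b" if "a \<in> carrier L" "b \<in> carrier L" "osum L a b = Some (eone L)" for a b
    unfolding cm_def using orthosupplement[OF that(1)] that by (intro the1_equality) blast+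
  have cmc: "cm a \<in> carrier L" if "a \<in> carrier L" for a
    using orthosupplement[OF that] cmu[OF that] by metis
  have Gc: "G n \<subseteq> carrier L" for n
  proof (induction n)
    case 0
    then show ?case using X zero_closed one_closed by (simp add: G0)
  next
    case (Suc n)
    have "cm ` G n \<subseteq> carrier L"
      using Suc.IH by (auto intro!: cmc)
    moreover have "(\<lambda>(a, b). sm a b) ` (G n \<times> G n) \<subseteq> carrier L"
      using Suc.IH by (auto intro!: smc)
    ultimately show ?case using Suc.IH by (simp add: GS)
  qed
  have mono: "G m \<subseteq> G n" if "m \<le> n" for m n
    using that by (rule lift_Suc_mono_le[rotated]) (auto simp: GS)
  have Gle: "|G n| \<le>o |UNIV :: 'u set|" for n
  proof (induction n)
    case 0
    have "|{ezero L}| \<le>o |UNIV :: 'u set|" "|{eone L}| \<le>o |UNIV :: 'u set|"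
      by (auto intro: card_of_ordLeqI[where f = "\<lambda>_. undefined"])
    then have "|{ezero L} \<union> {eone L}| \<le>o |UNIV :: 'u set|"
      by (intro card_of_Un_ordLeq_infinite inf)
    then have "|{ezero L, eone L}| \<le>o |UNIV :: 'u set|" by (simp add: insert_commute)
    then show ?case unfolding G0 by (intro card_of_Un_ordLeq_infinite inf le)
  next
    case (Suc n)
    have "|G n \<times> G n| \<le>o |UNIV :: 'u set|"
      by (rule card_of_Sigma_ordLeq_infinite[OF inf Suc]) (use Suc in simp)
    then show ?case unfolding GS
      by (intro card_of_Un_ordLeq_infinite inf Suc ordLeq_transitive[OF card_of_image])
  qed
  define S where "S = (\<Union>n. G n)"
  have "|UNIV :: nat set| \<le>o |UNIV :: 'u set|"
    using inf infinite_iff_card_of_nat by blast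
  then have "|S| \<le>o |UNIV :: 'u set|"
    unfolding S_def by (intro card_of_UNION_ordLeq_infinite inf) (use Gle in auto)
  then obtain g :: "'l \<Rightarrow> 'u" where "inj_on g S"
    using card_of_ordLeq[of S "UNIV :: 'u set"] by auto
  moreover have "X \<subseteq> S" using G0 by (auto simp: S_def)
  moreover have "subalgebra L S"
    unfolding subalgebra_def
  proof (intro conjI ballI allI impI)
    show "S \<subseteq> carrier L" using Gc by (auto simp: S_def)
    show "ezero L \<in> S" "eone L \<in> S" using G0 by (auto simp: S_def)
  next
    fix a b c assume "a \<in> S" "b \<in> S" and c: "osum L a b = Some c"
    then obtain m n where "a \<in> G m" "b \<in> G n" by (auto simp: S_def)
    then have "a \<in> G (max m n)" "b \<in> G (max m n)"
      using mono[of m "max m n"] mono[of n "max m n"] by auto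
    then have "sm a b \<in> G (Suc (max m n))" by (auto simp: GS)
    then show "c \<in> S" using c by (auto simp: S_def sm_def)
  next
    fix a b assume "a \<in> S" and b: "b \<in> carrier L" "osum L a b = Some (eone L)"
    then obtain n where n: "a \<in> G n" by (auto simp: S_def)
    then have "cm a \<in> G (Suc n)" by (auto simp: GS)
    moreover have "cm a = b" using cmu n Gc b by blast
    ultimately show "b \<in> S" by (auto simp: S_def)
  qed
  ultimately show thesis using that by blast
qed

lemma bimorphism_copy:
  assumes S: "subalgebra L S" and g: "inj_on g S" and \<beta>: "bimorphism E F L \<beta>"
    and in_S: "\<And>a b. a \<in> carrier E \<Longrightarrow> b \<in> carrier F \<Longrightarrow> \<beta> (a, b) \<in> S"
  shows "bimorphism E F (copy g S L) (g \<circ> \<beta>)"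
proof -
  show ?thesis
    unfolding bimorphism_def
  proof (intro conjI ballI allI impI)
    show "(g \<circ> \<beta>) (a, b) \<in> carrier (copy g S L)" if "a \<in> carrier E" "b \<in> carrier F" for a b
      using in_S that by (simp add: copy_def)
    show "(g \<circ> \<beta>) (eone E, eone F) = eone (copy g S L)"
      using \<beta> by (simp add: bimorphism_def copy_def)
  next
    fix a a' c b
    assume a: "a \<in> carrier E" "a' \<in> carrier E" "b \<in> carrier F" "osum E a a' = Some c"
    then have "osum L (\<beta> (a, b)) (\<beta> (a', b)) = Some (\<beta> (c, b))"
      using \<beta> unfolding bimorphism_def by blast
    then show "osum (copy g S L) ((g \<circ> \<beta>) (a, b)) ((g \<circ> \<beta>) (a', b)) = Some ((g \<circ> \<beta>) (c, b))"
      using a in_S by (simp add: osum_copy[OF g])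
  next
    fix a b b' c
    assume a: "a \<in> carrier E" "b \<in> carrier F" "b' \<in> carrier F" "osum F b b' = Some c"
    then have "osum L (\<beta> (a, b)) (\<beta> (a, b')) = Some (\<beta> (a, c))"
      using \<beta> unfolding bimorphism_def by blast
    then show "osum (copy g S L) ((g \<circ> \<beta>) (a, b)) ((g \<circ> \<beta>) (a, b')) = Some ((g \<circ> \<beta>) (a, c))"
      using a in_S by (simp add: osum_copy[OF g])
  qed
qed

lemma tensor_product_universal:
  fixes E :: "'a effect_struct" and F :: "'b effect_struct" and T :: "'t effect_struct"
    and L :: "'l effect_struct"
  assumes E: "effect_algebra E" and F: "effect_algebra F" and T: "tensor_product E F T \<rho>"
    and L: "effect_algebra L" and \<beta>: "bimorphism E F L \<beta>"
  shows "\<exists>!\<phi>. factors_through E F T \<rho> L \<beta> \<phi>"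
proof -
  let ?U = "UNIV :: ('t + 'a \<times> 'b \<times> nat) set"
  have ETA: "effect_algebra T" and \<rho>: "bimorphism E F T \<rho>"
    and univ: "\<And>(L :: ('t + 'a \<times> 'b \<times> nat) effect_struct) \<beta>. effect_algebra L \<Longrightarrow>
      bimorphism E F L \<beta> \<Longrightarrow> \<exists>!\<phi>. factors_through E F T \<rho> L \<beta> \<phi>"
    using T unfolding tensor_product_def by blast+
  have "inj (\<lambda>n::nat. Inr (undefined, undefined, n) :: 't + 'a \<times> 'b \<times> nat)"
    by (auto simp: inj_def)
  then have inf: "infinite ?U"
    by (meson finite_imageD finite_subset infinite_UNIV_nat subset_UNIV)
  have le1: "|\<beta> ` (carrier E \<times> carrier F)| \<le>o |?U|"
  proof -
    have "|carrier E \<times> carrier F| \<le>o |?U|"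
      by (intro card_of_ordLeqI[where f = "\<lambda>(a, b). Inr (a, b, 0)"]) (auto simp: inj_on_def)
    then show ?thesis using card_of_image ordLeq_transitive by blast
  qed
  have le2: "|carrier T| \<le>o |?U|"
    by (intro card_of_ordLeqI[where f = Inl]) (auto simp: inj_on_def)
  show ?thesis
  proof (rule ex_ex1I)
    have "\<beta> ` (carrier E \<times> carrier F) \<subseteq> carrier L" using \<beta> by (auto simp: bimorphism_def)
    from small_subalgebra[OF L this le1 inf]
    obtain S and g :: "'l \<Rightarrow> 't + 'a \<times> 'b \<times> nat" where
      S: "\<beta> ` (carrier E \<times> carrier F) \<subseteq> S" "subalgebra L S" and g: "inj_on g S" .
    have in_S: "\<And>a b. a \<in> carrier E \<Longrightarrow> b \<in> carrier F \<Longrightarrow> \<beta> (a, b) \<in> S" using S by auto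
    from univ[OF effect_algebra_copy[OF L S(2) g] bimorphism_copy[OF S(2) g \<beta> in_S]]
    obtain \<phi> where \<phi>: "factors_through E F T \<rho> (copy g S L) (g \<circ> \<beta>) \<phi>" by blast
    then have m: "morphism T (copy g S L) \<phi>" by (simp add: factors_through_def)
    have "factors_through E F T \<rho> L \<beta> (\<lambda>t. if t \<in> carrier T then inv_into S g (\<phi> t) else undefined)"
      using \<phi> morphism_copy_inv[OF S(2) g m ETA] \<rho> in_S
      by (auto simp: factors_through_def bimorphism_def inv_into_f_f[OF g])
    then show "\<exists>\<phi>. factors_through E F T \<rho> L \<beta> \<phi>" by blast
  next
    fix \<phi> \<psi> assume \<phi>: "factors_through E F T \<rho> L \<beta> \<phi>" and \<psi>: "factors_through E F T \<rho> L \<beta> \<psi>"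
    have "\<phi> ` carrier T \<union> \<psi> ` carrier T \<subseteq> carrier L"
      using \<phi> \<psi> by (auto simp: factors_through_def morphism_def)
    moreover have "|\<phi> ` carrier T \<union> \<psi> ` carrier T| \<le>o |?U|"
      by (intro card_of_Un_ordLeq_infinite inf) (rule ordLeq_transitive[OF card_of_image le2])+
    ultimately obtain S and g :: "'l \<Rightarrow> 't + 'a \<times> 'b \<times> nat" where
      S: "\<phi> ` carrier T \<union> \<psi> ` carrier T \<subseteq> S" "subalgebra L S" and g: "inj_on g S"
      by (rule small_subalgebra[OF L _ _ inf])
    have \<rho>T: "\<And>a b. a \<in> carrier E \<Longrightarrow> b \<in> carrier F \<Longrightarrow> \<rho> (a, b) \<in> carrier T"
      using \<rho> by (auto simp: bimorphism_def)
    have in_S: "\<beta> (a, b) \<in> S" if "a \<in> carrier E" "b \<in> carrier F" for a b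
    proof -
      have "\<beta> (a, b) = \<phi> (\<rho> (a, b))" using \<phi> that by (simp add: factors_through_def)
      then show ?thesis using S \<rho>T that by auto
    qed
    have *: "factors_through E F T \<rho> (copy g S L) (g \<circ> \<beta>) (\<lambda>t. if t \<in> carrier T then g (\<chi> t) else undefined)"
      if "factors_through E F T \<rho> L \<beta> \<chi>" "\<chi> ` carrier T \<subseteq> S" for \<chi>
      using that \<rho>T morphism_copy[OF S(2) g, of T \<chi>] ETA by (auto simp: factors_through_def)
    have "(\<lambda>t. if t \<in> carrier T then g (\<phi> t) else undefined) =
          (\<lambda>t. if t \<in> carrier T then g (\<psi> t) else undefined)"
      using univ[OF effect_algebra_copy[OF L S(2) g] bimorphism_copy[OF S(2) g \<beta> in_S]]
        *[OF \<phi>] *[OF \<psi>] S by auto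
    then have eq: "g (\<phi> t) = g (\<psi> t)" if "t \<in> carrier T" for t
      using that by (metis (mono_tags, lifting))
    show "\<phi> = \<psi>"
    proof
      fix t
      show "\<phi> t = \<psi> t"
      proof (cases "t \<in> carrier T")
        case True
        then have "\<phi> t \<in> S" "\<psi> t \<in> S" using S by auto
        then show ?thesis using inj_onD[OF g eq[OF True]] by simp
      next
        case False
        then show ?thesis using \<phi> \<psi> by (simp add: factors_through_def)
      qed
    qed
  qed
qed

end

theory Submission
  imports Defs
begin

text \<open>
  Since \<open>s\<close> is additive, \<open>(r, e) \<mapsto> \<rho> (r * s e, 1)\<close> is a bimorphism into \<open>T\<close>, so it factors
  uniquely through a morphism \<open>\<tau>\<close>.  As \<open>s 1 = 1\<close>, the morphism \<open>\<tau> \<circ> \<tau>\<close> factors the same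
  bimorphism, whence \<open>\<tau> \<circ> \<tau> = \<tau>\<close>.
\<close>

lemma effect_algebra_unit_interval: "effect_algebra unit_interval"
proof
  fix a assume a: "a \<in> carrier unit_interval"
  show "\<exists>!b. b \<in> carrier unit_interval \<and> osum unit_interval a b = Some (eone unit_interval)"
    by (rule ex1I[of _ "1 - a"]) (use a in \<open>simp_all add: unit_interval_def split: if_splits\<close>)
qed (auto simp: unit_interval_def split: if_splits)

lemma state_bounds:
  assumes "state E s" and "e \<in> carrier E"
  shows "0 \<le> s e" and "s e \<le> 1"
  using assms by (auto simp: state_def morphism_def unit_interval_def)

lemma state_one: "state E s \<Longrightarrow> s (eone E) = 1"
  by (simp add: state_def morphism_def unit_interval_def)

lemma state_add:
  assumes "state E s" and "a \<in> carrier E" and "b \<in> carrier E" and "osum E a b = Some c"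
  shows "s c = s a + s b"
proof -
  have "osum unit_interval (s a) (s b) = Some (s c)"
    using assms unfolding state_def morphism_def by blast
  then show ?thesis
    by (simp add: unit_interval_def split: if_splits)
qed

text \<open>The product \<open>r * s e\<close> is additive in \<open>r\<close> by distributivity and
  in \<open>e\<close> because \<open>s\<close> is additive, and it never leaves the unit interval.
  Additivity of \<open>\<rho>\<close> in its first argument, with the second held at
  \<open>eone F\<close>, carries this over to \<open>T\<close>. The application takes
  \<open>F\<close> to be \<open>E\<close>.\<close>

lemma bimorphism_scale_state:
  assumes E: "effect_algebra E" and F: "effect_algebra F"
    and s: "state E s" and \<rho>: "bimorphism unit_interval F T \<rho>"
  shows "bimorphism unit_interval E T (\<lambda>(r, e). \<rho> (r * s e, eone F))"
proof -
  have one: "eone F \<in> carrier F"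
    using F by (rule effect_algebra.one_closed)
  have I: "r * s e \<in> carrier unit_interval"
    if "r \<in> carrier unit_interval" and "e \<in> carrier E" for r e
    using that state_bounds[OF s, of e] by (simp add: unit_interval_def mult_le_one)
  \<comment> \<open>Both additivity conditions reduce to this one. Membership of \<open>z\<close> in
    the interval gives \<open>x + y \<le> 1\<close>, so that the orthosum of \<open>x\<close> and
    \<open>y\<close> is defined.\<close>
  have add: "osum T (\<rho> (x, eone F)) (\<rho> (y, eone F)) = Some (\<rho> (z, eone F))"
    if "x \<in> carrier unit_interval" "y \<in> carrier unit_interval" "z \<in> carrier unit_interval"
      "z = x + y" for x y z
  proof -
    have "osum unit_interval x y = Some z"
      using that by (simp add: unit_interval_def)
    then show ?thesis
      using \<rho> one that unfolding bimorphism_def by blast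
  qed
  show ?thesis
    unfolding bimorphism_def case_prod_conv
  proof (intro conjI ballI allI impI)
    show "\<rho> (r * s e, eone F) \<in> carrier T"
      if "r \<in> carrier unit_interval" "e \<in> carrier E" for r e
      using \<rho> I[OF that] one by (simp add: bimorphism_def)
    show "\<rho> (eone unit_interval * s (eone E), eone F) = eone T"
      using \<rho> state_one[OF s] by (simp add: bimorphism_def)
  next
    fix r r' q e
    assume r: "r \<in> carrier unit_interval" "r' \<in> carrier unit_interval" and e: "e \<in> carrier E"
      and sum: "osum unit_interval r r' = Some q"
    have "q \<in> carrier unit_interval"
      using effect_algebra.osum_closed[OF effect_algebra_unit_interval r sum] .
    moreover have "q = r + r'"
      using sum by (simp add: unit_interval_def split: if_splits)
    ultimately show "osum T (\<rho> (r * s e, eone F)) (\<rho> (r' * s e, eone F)) = Some (\<rho> (q * s e, eone F))"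
      using r e by (intro add I) (auto simp: algebra_simps)
  next
    fix r e e' d
    assume r: "r \<in> carrier unit_interval" and e: "e \<in> carrier E" "e' \<in> carrier E"
      and sum: "osum E e e' = Some d"
    have "d \<in> carrier E"
      using effect_algebra.osum_closed[OF E e sum] .
    then show "osum T (\<rho> (r * s e, eone F)) (\<rho> (r * s e', eone F)) = Some (\<rho> (r * s d, eone F))"
      using r e state_add[OF s e sum] by (intro add I) (auto simp: algebra_simps)
  qed
qed

text \<open>This separates the morphism part, which existence in the universal property supplies,
  from idempotence, which comes from uniqueness.\<close>

lemma state_operator_iff_idempotent_morphism:
  "state_operator E \<tau> \<longleftrightarrow> morphism E E \<tau> \<and> (\<forall>a \<in> carrier E. \<tau> (\<tau> a) = \<tau> a)"
  unfolding state_operator_def morphism_def by blast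

text \<open>The composite is reset to \<open>undefined\<close> off the carrier because
  \<open>factors_through\<close> demands extensionality; only in this form can uniqueness compare it
  with another factorization.\<close>

lemma morphism_compose_extensional:
  assumes E: "effect_algebra E" and "morphism E F \<phi>" and "morphism F G \<psi>"
  shows "morphism E G (\<lambda>t. if t \<in> carrier E then \<psi> (\<phi> t) else undefined)"
proof -
  let ?h = "\<lambda>t. if t \<in> carrier E then \<psi> (\<phi> t) else undefined"
  have "osum G (?h a) (?h b) = Some (?h c)"
    if "a \<in> carrier E" "b \<in> carrier E" "osum E a b = Some c" for a b c
  proof -
    have "osum F (\<phi> a) (\<phi> b) = Some (\<phi> c)" "\<phi> a \<in> carrier F" "\<phi> b \<in> carrier F"
      using assms(2) that unfolding morphism_def by blast+
    then have "osum G (\<psi> (\<phi> a)) (\<psi> (\<phi> b)) = Some (\<psi> (\<phi> c))"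
      using assms(3) unfolding morphism_def by blast
    \<comment> \<open>Without this, \<open>?h c\<close> could be the default value instead of
      \<open>\<psi> (\<phi> c)\<close>.\<close>
    moreover have "c \<in> carrier E"
      using effect_algebra.osum_closed[OF E that] .
    ultimately show ?thesis
      using that by simp
  qed
  moreover have "?h a \<in> carrier G" if "a \<in> carrier E" for a
    using assms(2,3) that by (simp add: morphism_def)
  moreover have "?h (eone E) = eone G"
    using assms(2,3) effect_algebra.one_closed[OF E] by (simp add: morphism_def)
  ultimately show ?thesis
    unfolding morphism_def by blast
qed

theorem theorem3p7:
  fixes E :: "'e effect_struct" and s :: "'e \<Rightarrow> real"
    and T :: "'t effect_struct" and \<rho> :: "real \<times> 'e \<Rightarrow> 't"
  assumes "effect_algebra E"
    and "state E s"
    and "tensor_product unit_interval E T \<rho>"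
  shows "\<exists>!\<tau>. (\<forall>t. t \<notin> carrier T \<longrightarrow> \<tau> t = undefined) \<and> state_operator T \<tau> \<and>
           (\<forall>r \<in> carrier unit_interval. \<forall>e \<in> carrier E. \<tau> (\<rho> (r, e)) = \<rho> (r * s e, eone E))"
proof -
  let ?\<beta> = "\<lambda>(r, e). \<rho> (r * s e, eone E)"
  let ?fac = "factors_through unit_interval E T \<rho> T ?\<beta>"
  have T: "effect_algebra T" and \<rho>: "bimorphism unit_interval E T \<rho>"
    using assms(3) by (simp_all add: tensor_product_def)
  \<comment> \<open>The codomain here is \<open>T\<close> itself, whose type \<open>'t\<close> is
    not the one in the definition of \<open>tensor_product\<close>; hence the universal property for
    arbitrary types.\<close>
  have univ: "\<exists>!\<phi>. ?fac \<phi>"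
    using tensor_product_universal[OF effect_algebra_unit_interval assms(1,3) T]
      bimorphism_scale_state[OF assms(1,1,2) \<rho>] by blast
  \<comment> \<open>Stated for every factorization, since the final equivalence needs it for an
    arbitrary \<open>\<tau>\<close>.\<close>
  have idem: "\<phi> (\<phi> t) = \<phi> t" if \<phi>: "?fac \<phi>" and t: "t \<in> carrier T" for \<phi> t
  proof -
    let ?\<phi>\<phi> = "\<lambda>t. if t \<in> carrier T then \<phi> (\<phi> t) else undefined"
    have m: "morphism T T \<phi>"
      and eq: "\<And>r e. r \<in> carrier unit_interval \<Longrightarrow> e \<in> carrier E \<Longrightarrow>
        \<phi> (\<rho> (r, e)) = \<rho> (r * s e, eone E)"
      using \<phi> by (auto simp: factors_through_def)
    have "?\<phi>\<phi> (\<rho> (r, e)) = \<rho> (r * s e, eone E)"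
      if r: "r \<in> carrier unit_interval" and e: "e \<in> carrier E" for r e
    proof -
      have "\<rho> (r, e) \<in> carrier T"
        using \<rho> r e by (simp add: bimorphism_def)
      \<comment> \<open>This allows a second use of \<open>eq\<close>, now at the pair
        \<open>(r * s e, eone E)\<close>; the new factor \<open>s (eone E)\<close> equals 1, so
        nothing changes.\<close>
      moreover have "r * s e \<in> carrier unit_interval"
        using r state_bounds[OF assms(2) e] by (simp add: unit_interval_def mult_le_one)
      ultimately show ?thesis
        using r e effect_algebra.one_closed[OF assms(1)] by (simp add: eq state_one[OF assms(2)])
    qed
    then have "?fac ?\<phi>\<phi>"
      using morphism_compose_extensional[OF T m m] by (simp add: factors_through_def)
    then have "?\<phi>\<phi> = \<phi>"
      using univ \<phi> by blast
    from fun_cong[OF this, of t] show ?thesis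
      using t by simp
  qed
  \<comment> \<open>Idempotence is automatic for a factorization by \<open>idem\<close>, so the
    required maps are exactly the factorizations of \<open>?\<beta>\<close>, and unique existence
    transfers.\<close>
  have "(\<forall>t. t \<notin> carrier T \<longrightarrow> \<tau> t = undefined) \<and> state_operator T \<tau> \<and>
      (\<forall>r \<in> carrier unit_interval. \<forall>e \<in> carrier E. \<tau> (\<rho> (r, e)) = \<rho> (r * s e, eone E))
    \<longleftrightarrow> ?fac \<tau>" for \<tau>
    unfolding state_operator_iff_idempotent_morphism
    using idem[of \<tau>] unfolding factors_through_def case_prod_conv by blast
  then show ?thesis
    using univ by simp
qed

end
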